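(* Let $m$, $t$, $a$ and $i$ be positive integers satisfying $m=\binom{t}{3}-a$, $3\leq a\leq t-2$ and $i\ge 1$. Let $G=([t],E)$ be a left-compressed $3$-graph with $m$ edges. If the triple that is minimum in the colex ordering among the edges of the complement $G^{c}$ is $(t-2-i)(t-2)t$, then $\lambda(G)\leq\lambda(C_{3,m})$.
   Context: $[n]=\{1,2,\ldots,n\}$; $V^{(3)}$ is the family of all $3$-subsets of $V$. A $3$-graph $G=(V,E)$ consists of a vertex set $V$ and an edge set $E\subseteq V^{(3)}$; a triple $\{p,q,s\}$ is written $pqs$. The complement $G^c$ is the $3$-graph on $V$ with edge set $V^{(3)}\setminus E$. A $3$-graph $G=([n],E)$ is left-compressed if $j_1j_2j_3\in E$ implies $i_1i_2i_3\in E$ for every triple $i_1i_2i_3$ with $i_p\le j_p$ for $p=1,2,3$. Colex ordering on $3$-subsets of the positive integers $\mathbb{N}$: for distinct $A,B$, $A<B$ iff $\max(A\triangle B)\in B$. $C_{3,m}$ is the $3$-graph with $m$ edges whose edges are the first $m$ sets in the colex ordering of $\mathbb{N}^{(3)}$. The Lagrangian of a $3$-graph $G$ on $[n]$ is $\lambda(G)=\max\{\sum_{pqs\in E(G)}x_px_qx_s : x_1+\cdots+x_n=1,\ x_j\ge 0 \text{ for all } j\}$. *)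

theory Defs
  imports "HOL-Analysis.Analysis" "HOL-Library.Ramsey" "HOL-Library.Nat_Bijection"
begin

text \<open>
  A 3-graph is a pair of a vertex set and an edge set.
  \<open>nsets V 3\<close> (from \<open>HOL-Library.Ramsey\<close>) is the family of all 3-element subsets of \<open>V\<close>.
\<close>

type_synonym graph3 = "nat set \<times> nat set set"

abbreviation verts :: "graph3 \<Rightarrow> nat set" where "verts \<equiv> fst"

abbreviation edges :: "graph3 \<Rightarrow> nat set set" where "edges \<equiv> snd"

definition three_graph :: "graph3 \<Rightarrow> bool" where
  "three_graph G \<longleftrightarrow> edges G \<subseteq> nsets (verts G) 3"

definition complement3 :: "graph3 \<Rightarrow> graph3" where
  "complement3 G = (verts G, nsets (verts G) 3 - edges G)"

text \<open>
  Triples are listed in increasing order. The bound \<open>1 \<le> i1\<close> together with \<open>i3 \<le> j3\<close> keeps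
  \<open>{i1, i2, i3}\<close> inside the vertex set \<open>{1..n}\<close>.
\<close>

definition left_compressed :: "graph3 \<Rightarrow> bool" where
  "left_compressed G \<longleftrightarrow>
     (\<forall>i1 i2 i3 j1 j2 j3.
        1 \<le> i1 \<and> i1 < i2 \<and> i2 < i3 \<and> j1 < j2 \<and> j2 < j3 \<and>
        i1 \<le> j1 \<and> i2 \<le> j2 \<and> i3 \<le> j3 \<and> {j1, j2, j3} \<in> edges G
        \<longrightarrow> {i1, i2, i3} \<in> edges G)"

definition colex_less :: "nat set \<Rightarrow> nat set \<Rightarrow> bool" where
  "colex_less A B \<longleftrightarrow> A \<noteq> B \<and> Max (sym_diff A B) \<in> B"

definition is_colex_min :: "nat set \<Rightarrow> nat set set \<Rightarrow> bool" where
  "is_colex_min A F \<longleftrightarrow> A \<in> F \<and> (\<forall>B\<in>F. B \<noteq> A \<longrightarrow> colex_less A B)"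

text \<open>
  A triple is among the first \<open>m\<close> in colex order iff fewer than \<open>m\<close> triples of positive integers
  precede it; lemma \<open>card_colex_initial\<close> below confirms that there are exactly \<open>m\<close> of these.
\<close>

definition colex_initial :: "nat \<Rightarrow> nat set set" where
  "colex_initial m =
     {A \<in> nsets {1..} 3. card {B \<in> nsets {1..} 3. colex_less B A} < m}"

text \<open>
  The vertex set is the set of covered vertices; adding isolated vertices would not change the
  Lagrangian.
\<close>

definition colex_graph :: "nat \<Rightarrow> graph3" where
  "colex_graph m = (\<Union>(colex_initial m), colex_initial m)"

definition weightings :: "nat set \<Rightarrow> (nat \<Rightarrow> real) set" where
  "weightings V = {x. (\<Sum>j\<in>V. x j) = 1 \<and> (\<forall>j\<in>V. 0 \<le> x j)}"

definition edge_poly :: "graph3 \<Rightarrow> (nat \<Rightarrow> real) \<Rightarrow> real" where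
  "edge_poly G x = (\<Sum>e\<in>edges G. \<Prod>j\<in>e. x j)"

text \<open>
  The supremum is a maximum for every 3-graph on a finite nonempty vertex set, see
  \<open>lagrangian_attained\<close> below.
\<close>

definition lagrangian :: "graph3 \<Rightarrow> real" where
  "lagrangian G = (SUP x\<in>weightings (verts G). edge_poly G x)"

lemma lagrangian_attained:
  assumes G: "three_graph G" and fin: "finite (verts G)" and ne: "verts G \<noteq> {}"
  shows "\<exists>x\<in>weightings (verts G).
           lagrangian G = edge_poly G x \<and> (\<forall>y\<in>weightings (verts G). edge_poly G y \<le> edge_poly G x)"
proof -
  let ?V = "verts G"
  define K :: "(nat \<Rightarrow> real) set" where "K = (\<Pi>\<^sub>E j\<in>UNIV. if j \<in> ?V then {0..1} else {0})"
  define S where "S = K \<inter> {x. (\<Sum>j\<in>?V. x j) = 1}"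
  have "compactin (product_topology (\<lambda>_. euclidean) UNIV) K"
    unfolding K_def by (subst compactin_PiE) auto
  then have "compact K"
    by (simp add: euclidean_product_topology)
  moreover have "closed {x::nat \<Rightarrow> real. (\<Sum>j\<in>?V. x j) = 1}"
    by (intro closed_Collect_eq continuous_intros) auto
  ultimately have cS: "compact S"
    unfolding S_def by (rule compact_Int_closed)
  obtain v where v: "v \<in> ?V" using ne by blast
  have "(\<lambda>j. if j = v then 1 else 0) \<in> S"
    using v fin by (auto simp: S_def K_def)
  then have neS: "S \<noteq> {}" by blast
  have "continuous_on S (edge_poly G)"
    unfolding edge_poly_def
    by (intro continuous_intros continuous_on_subset[OF continuous_on_product_coordinates]) auto
  then obtain x where x: "x \<in> S" and mx: "\<And>y. y \<in> S \<Longrightarrow> edge_poly G y \<le> edge_poly G x"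
    using continuous_attains_sup[OF cS neS] by blast
  have "0 \<le> x j" if "j \<in> ?V" for j
    using x that by (auto simp: S_def K_def PiE_iff dest!: spec[of _ j])
  then have xW: "x \<in> weightings ?V"
    using x by (auto simp: S_def weightings_def)
  have up: "edge_poly G y \<le> edge_poly G x" if y: "y \<in> weightings ?V" for y
  proof -
    let ?z = "\<lambda>j. if j \<in> ?V then y j else 0"
    have "y j \<le> 1" if "j \<in> ?V" for j
      using member_le_sum[of j ?V y] that y fin by (auto simp: weightings_def)
    then have "?z \<in> S"
      using y by (auto simp: S_def K_def weightings_def)
    moreover have "edge_poly G ?z = edge_poly G y"
      unfolding edge_poly_def using G
      by (intro sum.cong prod.cong) (auto simp: three_graph_def nsets_def)
    ultimately show ?thesis using mx by metis
  qed
  have "lagrangian G = edge_poly G x"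
    unfolding lagrangian_def by (rule cSup_eq_maximum) (use xW up in auto)
  with xW up show ?thesis by blast
qed

lemma colex_less_set_encode:
  assumes A: "finite A" and B: "finite B" and AB: "colex_less A B"
  shows "set_encode A < set_encode B"
proof -
  define k where "k = Max (sym_diff A B)"
  have fin: "finite (sym_diff A B)" using A B by simp
  have ne: "sym_diff A B \<noteq> {}" using AB by (auto simp: colex_less_def)
  have kB: "k \<in> B" using AB by (simp add: colex_less_def k_def)
  with Max_in[OF fin ne] have kA: "k \<notin> A" by (auto simp: k_def)
  have le: "j \<le> k" if "j \<in> sym_diff A B" for j
    unfolding k_def using Max_ge[OF fin that] .
  have "A - B \<subseteq> {..<k}"
    using le kB by (force simp: le_less)
  then have "(\<Sum>j\<in>A - B. 2 ^ j) \<le> (\<Sum>j<k. 2 ^ j :: nat)"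
    by (intro sum_mono2) auto
  also have "\<dots> < 2 ^ k"
    by (simp add: lessThan_atLeast0 sum_power2)
  also have "\<dots> \<le> (\<Sum>j\<in>B - A. 2 ^ j)"
    using kA kB B by (intro member_le_sum) auto
  finally have lt: "(\<Sum>j\<in>A - B. 2 ^ j) < (\<Sum>j\<in>B - A. 2 ^ j :: nat)" .
  have "set_encode A = (\<Sum>j\<in>A \<inter> B. 2 ^ j) + (\<Sum>j\<in>A - B. 2 ^ j)"
    unfolding set_encode_def using A by (simp add: sum.Int_Diff)
  moreover have "set_encode B = (\<Sum>j\<in>A \<inter> B. 2 ^ j) + (\<Sum>j\<in>B - A. 2 ^ j)"
    unfolding set_encode_def using B by (simp add: sum.Int_Diff[of B _ A] Int_commute)
  ultimately show ?thesis using lt by simp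
qed

lemma colex_less_linear:
  assumes "finite A" "finite B" "A \<noteq> B"
  shows "colex_less A B \<or> colex_less B A"
proof -
  have "Max (sym_diff A B) \<in> sym_diff A B"
    using assms by (intro Max_in) auto
  then show ?thesis
    using assms(3) by (auto simp: colex_less_def Un_commute)
qed

lemma colex_less_iff_set_encode:
  assumes "finite A" "finite B"
  shows "colex_less A B \<longleftrightarrow> set_encode A < set_encode B"
  by (metis assms colex_less_linear colex_less_set_encode less_asym less_irrefl)

lemma card_colex_initial: "card (colex_initial m) = m"
proof -
  let ?T = "nsets {1::nat..} 3"
  define S where "S = set_encode ` ?T"
  have fT: "finite A" if "A \<in> ?T" for A using that by (simp add: nsets_def)
  have inj: "inj_on set_encode ?T"
    using inj_on_set_encode by (rule inj_on_subset) (use fT in blast)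
  have "inj (\<lambda>n. {1, 2, n + 3 :: nat})"
    by (rule injI) (auto simp: doubleton_eq_iff insert_eq_iff)
  then have "infinite (range (\<lambda>n. {1, 2, n + 3 :: nat}))"
    by (rule range_inj_infinite)
  moreover have "range (\<lambda>n. {1, 2, n + 3 :: nat}) \<subseteq> ?T"
    by (auto simp: nsets_def)
  ultimately have "infinite ?T" using finite_subset by blast
  then have inf: "infinite S"
    unfolding S_def using inj finite_image_iff by blast
  have rank: "card {s \<in> S. s < enumerate S n} = n" for n
  proof -
    have "{s \<in> S. s < enumerate S n} = enumerate S ` {..<n}"
      using enumerate_mono_iff[OF inf] enumerate_in_set[OF inf] enumerate_Ex[of S]
      by (fastforce simp: inf)
    then show ?thesis
      by (simp add: card_image inj_on_def inj_enumerate[OF inf, THEN inj_eq])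
  qed
  have pre: "card {B \<in> ?T. colex_less B A} = card {s \<in> S. s < set_encode A}" if A: "A \<in> ?T" for A
  proof -
    have "{s \<in> S. s < set_encode A} = set_encode ` {B \<in> ?T. colex_less B A}"
      using fT A by (auto simp: S_def colex_less_iff_set_encode)
    then show ?thesis
      by (metis (no_types, lifting) card_image inj inj_on_subset mem_Collect_eq subsetI)
  qed
  have "set_encode ` colex_initial m = {s \<in> S. card {r \<in> S. r < s} < m}"
    using pre by (auto simp: colex_initial_def S_def)
  also have "\<dots> = enumerate S ` {..<m}"
    using rank enumerate_in_set[OF inf] enumerate_Ex[of S] by (fastforce simp: inf)
  finally have "card (set_encode ` colex_initial m) = m"
    by (simp add: card_image inj_on_def inj_enumerate[OF inf, THEN inj_eq])
  moreover have "inj_on set_encode (colex_initial m)"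
    using inj by (rule inj_on_subset) (auto simp: colex_initial_def)
  ultimately show ?thesis by (simp add: card_image)
qed

end

theory Submission
  imports Defs
begin

text \<open>
  Left-compressedness and the colex-minimal non-edge determine \<open>G\<close> up to one parameter: its non-edges
  are \<open>{p, t - 1, t}\<close> for the \<open>b\<close> largest \<open>p \<le> t - 2\<close> and \<open>{p, t - 2, t}\<close> for the \<open>i\<close> largest
  \<open>p \<le> t - 3\<close>, where \<open>b + i = a\<close> and \<open>i < b\<close> (\<open>complement_eq_two_fan\<close>). The colex graph with \<open>m\<close>
  edges is the member of the same family with parameters \<open>a\<close> and \<open>0\<close>
  (\<open>colex_graph_eq_two_fan_graph\<close>). It therefore suffices that the Lagrangian does not decrease from
  \<open>(b, i)\<close> to \<open>(b + 1, i - 1)\<close> (\<open>lagrangian_two_fan_step\<close>).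

  One such step makes the non-edge \<open>{d, t - 2, t}\<close> an edge and the edge \<open>{p, t - 1, t}\<close> a
  non-edge, where \<open>d = t - 2 - i\<close> and \<open>p = t - 2 - b\<close>. At an optimal weighting \<open>x\<close> of the old graph this
  may lose: \<open>p\<close> may be heavier than \<open>d\<close>, and \<open>t - 2\<close> need not be enough heavier than \<open>t - 1\<close> to make up for
  it. So \<open>x\<close> is adapted to the new graph, by averaging the weights of \<open>p\<close> and \<open>d\<close>, which have become
  symmetric, and by moving some weight from \<open>t - 1\<close> to \<open>t - 2\<close>, which has gained an edge while \<open>t - 1\<close>
  has lost one. A transfer of weight between two vertices changes the edge polynomial
  by an explicit quadratic (\<open>esym3_transfer\<close>), and the optimality of \<open>x\<close> enters through the same
  transfers. With all of this the net gain reduces to the elementary inequality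
  \<open>sq_times_complement_mono\<close>. The computation is \<open>exchange_step\<close>.
\<close>


section \<open>Transfers of weight and the elementary symmetric polynomials\<close>

definition esym :: "nat \<Rightarrow> nat set \<Rightarrow> (nat \<Rightarrow> real) \<Rightarrow> real" where
  "esym k V x = (\<Sum>e\<in>nsets V k. \<Prod>j\<in>e. x j)"

lemma esym_cong: "(\<And>j. j \<in> V \<Longrightarrow> x j = y j) \<Longrightarrow> esym k V x = esym k V y"
  unfolding esym_def by (intro sum.cong prod.cong) (auto simp: nsets_def)

lemma esym_1: "esym (Suc 0) V x = (\<Sum>j\<in>V. x j)"
proof -
  have "nsets V (Suc 0) = (\<lambda>j. {j}) ` V"
    by (auto simp: nsets_def card_1_singleton_iff)
  then show ?thesis
    by (simp add: esym_def sum.reindex inj_on_def)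
qed

lemma esym_insert:
  assumes "finite V" "v \<notin> V"
  shows "esym (Suc k) (insert v V) x = esym (Suc k) V x + x v * esym k V x"
proof -
  have "nsets (insert v V) (Suc k) = nsets V (Suc k) \<union> insert v ` nsets V k"
  proof (intro equalityI subsetI)
    fix e assume e: "e \<in> nsets (insert v V) (Suc k)"
    show "e \<in> nsets V (Suc k) \<union> insert v ` nsets V k"
    proof (cases "v \<in> e")
      case True
      then have "e = insert v (e - {v})" "e - {v} \<in> nsets V k"
        using e by (auto simp: nsets_def)
      then show ?thesis by blast
    qed (use e in \<open>auto simp: nsets_def\<close>)
  next
    fix e assume "e \<in> nsets V (Suc k) \<union> insert v ` nsets V k"
    then show "e \<in> nsets (insert v V) (Suc k)"
    proof
      assume "e \<in> insert v ` nsets V k"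
      then obtain e' where e': "e = insert v e'" "e' \<in> nsets V k" by blast
      then have "v \<notin> e'" using assms by (auto simp: nsets_def)
      then show ?thesis using e' by (auto simp: nsets_def)
    qed (auto simp: nsets_def)
  qed
  moreover have "nsets V (Suc k) \<inter> insert v ` nsets V k = {}"
    using assms by (auto simp: nsets_def)
  moreover have "inj_on (insert v) (nsets V k)"
    using assms by (intro inj_onI) (auto simp: nsets_def insert_eq_iff)
  moreover have "(\<Prod>j\<in>insert v e. x j) = x v * (\<Prod>j\<in>e. x j)" if "e \<in> nsets V k" for e
    using that assms by (subst prod.insert) (auto simp: nsets_def)
  ultimately show ?thesis
    using assms(1)
    by (simp add: esym_def sum.union_disjoint finite_imp_finite_nsets sum.reindex sum_distrib_left)
qed

definition transfer :: "(nat \<Rightarrow> real) \<Rightarrow> nat \<Rightarrow> nat \<Rightarrow> real \<Rightarrow> nat \<Rightarrow> real" where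
  "transfer x p q \<epsilon> = x(p := x p + \<epsilon>, q := x q - \<epsilon>)"

lemma sum_transfer_other:
  "p \<notin> S \<Longrightarrow> q \<notin> S \<Longrightarrow> sum (transfer x p q \<epsilon>) S = sum x S"
  by (intro sum.cong) (auto simp: transfer_def)

text \<open>
  Seen from \<open>p\<close> and \<open>q\<close>, the polynomial depends on \<open>x p + x q\<close>, which a transfer preserves, and on
  the product \<open>x p * x q\<close>, whose coefficient is the remaining mass.
\<close>

lemma esym3_transfer:
  assumes "finite V" "p \<in> V" "q \<in> V" "p \<noteq> q"
  shows "esym 3 V (transfer x p q \<epsilon>)
       = esym 3 V x + (\<epsilon> * (x q - x p) - \<epsilon>\<^sup>2) * (sum x V - x p - x q)"
proof -
  define W where "W = V - {p, q}"
  have V: "V = insert p (insert q W)" and W: "finite W" "p \<notin> W" "q \<notin> W"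
    using assms by (auto simp: W_def)
  have split: "esym 3 V y = esym 3 W y + (y p + y q) * esym 2 W y + y p * y q * sum y W" for y
    using W assms(4) esym_insert[of W q 2 y] esym_insert[of W q 1 y]
      esym_insert[of "insert q W" p 2 y]
    by (simp add: V esym_1 numeral_2_eq_2 numeral_3_eq_3 algebra_simps)
  have same: "esym k W (transfer x p q \<epsilon>) = esym k W x" for k
    using W by (intro esym_cong) (auto simp: transfer_def)
  have "sum x V = x p + x q + sum x W"
    using W assms(4) by (simp add: V)
  then show ?thesis
    using assms(4) W
    by (simp add: split same sum_transfer_other)
       (simp add: transfer_def algebra_simps power2_eq_square)
qed

lemma transfer_weightings:
  assumes "finite V" "p \<in> V" "q \<in> V" "p \<noteq> q" "x \<in> weightings V"
    and "- x p \<le> \<epsilon>" "\<epsilon> \<le> x q"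
  shows "transfer x p q \<epsilon> \<in> weightings V"
proof -
  define W where "W = V - {p, q}"
  have V: "V = insert p (insert q W)" and W: "finite W" "p \<notin> W" "q \<notin> W"
    using assms by (auto simp: W_def)
  have "sum (transfer x p q \<epsilon>) V = sum x V"
    using W assms(4) by (simp add: V sum_transfer_other) (simp add: transfer_def)
  then show ?thesis
    using assms by (auto simp: weightings_def transfer_def)
qed

section \<open>Trading one non-edge for another\<close>

text \<open>
  If a transfer of mass \<open>\<epsilon>\<close> changes the objective by \<open>(\<epsilon> * c - \<epsilon>\<^sup>2) * K + \<epsilon> * J\<close> and never helps for
  small \<open>\<epsilon> \<ge> 0\<close>, then the derivative at \<open>0\<close> is not positive. Only transfers out of a vertex of
  positive weight \<open>q\<close> are available, so a vertex of weight zero yields no condition.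
\<close>

lemma first_order_condition:
  fixes c K J q :: real
  assumes "q > 0" and "\<And>\<epsilon>. 0 \<le> \<epsilon> \<Longrightarrow> \<epsilon> \<le> q \<Longrightarrow> (\<epsilon> * c - \<epsilon>\<^sup>2) * K + \<epsilon> * J \<le> 0"
  shows "c * K + J \<le> 0"
proof (rule ccontr)
  assume neg: "\<not> c * K + J \<le> 0"
  define \<epsilon> where "\<epsilon> = min q ((c * K + J) / (2 * (\<bar>K\<bar> + 1)))"
  have e: "0 < \<epsilon>" "\<epsilon> \<le> q" using neg assms(1) by (auto simp: \<epsilon>_def)
  have "\<epsilon> * (2 * (\<bar>K\<bar> + 1)) \<le> c * K + J"
    by (simp add: \<epsilon>_def min_le_iff_disj flip: pos_le_divide_eq)
  moreover have "\<epsilon> * (2 * (\<bar>K\<bar> + 1)) = 2 * (\<epsilon> * \<bar>K\<bar>) + 2 * \<epsilon>" by (simp add: algebra_simps)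
  moreover have "\<epsilon> * K \<le> \<epsilon> * \<bar>K\<bar>" using e by (intro mult_left_mono) auto
  moreover have "0 \<le> \<epsilon> * \<bar>K\<bar>" using e by simp
  ultimately have "0 < c * K + J - \<epsilon> * K" using e(1) by linarith
  then have "0 < \<epsilon> * (c * K + J - \<epsilon> * K)" using e by simp
  also have "\<dots> = (\<epsilon> * c - \<epsilon>\<^sup>2) * K + \<epsilon> * J"
    by (simp add: algebra_simps power2_eq_square)
  also have "\<dots> \<le> 0" using assms(2)[of \<epsilon>] e by simp
  finally show False by simp
qed

text \<open>
  The map \<open>s \<mapsto> s\<^sup>2 * (1 - s)\<close> increases on \<open>{0..2/3}\<close> only. Since \<open>s\<close> and \<open>W\<close> will be the weights of two
  disjoint pairs of vertices, \<open>s + W \<le> 1\<close>, and that makes the comparison of its values at \<open>W\<close> and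
  \<open>s\<close> valid on the whole range.
\<close>

lemma sq_times_complement_mono:
  fixes s W z :: real
  assumes "0 \<le> W" "W \<le> s" "s + W \<le> 1" "0 \<le> z"
  shows "W\<^sup>2 * (1 - W - z) \<le> s\<^sup>2 * (1 - s)"
proof -
  have "(s + W)\<^sup>2 \<le> s + W"
    using assms mult_left_mono[of "s + W" 1 "s + W"] by (simp add: power2_eq_square)
  moreover have "0 \<le> s * W" using assms by simp
  ultimately have "0 \<le> s + W - s\<^sup>2 - s * W - W\<^sup>2"
    by (simp add: power2_eq_square algebra_simps)
  then have "0 \<le> (s - W) * (s + W - s\<^sup>2 - s * W - W\<^sup>2)"
    using assms by simp
  also have "\<dots> = s\<^sup>2 * (1 - s) - W\<^sup>2 * (1 - W)"
    by (simp add: power2_eq_square algebra_simps)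
  finally have "W\<^sup>2 * (1 - W) \<le> s\<^sup>2 * (1 - s)" by simp
  moreover have "0 \<le> W\<^sup>2 * z" using assms by simp
  ultimately show ?thesis by (simp add: algebra_simps)
qed

text \<open>
  The heart of the proof. In the application \<open>u = t - 2\<close>, \<open>v = t - 1\<close> and \<open>w = t\<close>, and \<open>f\<close>, \<open>g\<close> are the
  edge polynomials of the graphs before and after the non-edge \<open>duw\<close> has been traded for \<open>pvw\<close>.
  With the maximiser \<open>x\<close> of \<open>f\<close> itself the trade gains \<open>x w * (x u * x d - x v * x p)\<close>, which may be
  negative; in that case \<open>w\<close>, \<open>v\<close> and \<open>p\<close> have positive weight, and optimality forces
  \<open>x w \<le> x v \<le> x u \<le> x d\<close> and \<open>x v \<le> x p\<close>. After the trade \<open>p\<close> and \<open>d\<close> are twins, so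
  their weights are averaged, and \<open>u\<close> has become better than \<open>v\<close>, so mass is moved from \<open>v\<close> to \<open>u\<close>.

  Write \<open>s = x p + x d\<close>, \<open>W = x u + x v\<close>, \<open>P = 1 - s\<close> and \<open>R = 1 - W - x w\<close>. The stationarity
  equations \<open>(x p - x d) * P = x w * W\<close> and \<open>(x u - x v) * R = x w * sum x B\<close> turn the total gain into
  a quantity that is at least \<open>(x w)\<^sup>2 / 4 * (s\<^sup>2 / R - W\<^sup>2 / P)\<close>, and \<open>W\<^sup>2 * R \<le> s\<^sup>2 * P\<close> because
  \<open>W \<le> s\<close> and \<open>s + W \<le> 1\<close>. The possible loss from the trade alone is of order \<open>(x w)\<^sup>2\<close> as well, which is why
  adjusting the weights, a second-order effect, can make up for it.
\<close>

lemma exchange_step: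
  fixes x :: "nat \<Rightarrow> real"
  assumes fin: "finite V"
    and sub: "{p, d, u, v, w} \<union> B \<union> D \<subseteq> V" and dist: "distinct [p, d, u, v, w]"
    and disj: "B \<inter> D = {}" "{p, d, u, v, w} \<inter> (B \<union> D) = {}"
    and f: "\<And>y. f y = esym 3 V y
               - y w * (y v * (sum y B + sum y D + y d + y u) + y u * (sum y D + y d))"
    and g: "\<And>y. g y = esym 3 V y
               - y w * (y v * (sum y B + sum y D + y d + y p + y u) + y u * sum y D)"
    and x: "x \<in> weightings V" and max: "\<And>y. y \<in> weightings V \<Longrightarrow> f y \<le> f x"
  shows "\<exists>y\<in>weightings V. f x \<le> g y"
proof (cases "x w * (x u * x d - x v * x p) \<ge> 0")
  case True
  then have "f x \<le> g x" unfolding f g by (simp add: algebra_simps)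
  then show ?thesis using x by blast
next
  case False
  have inV: "p \<in> V" "d \<in> V" "u \<in> V" "v \<in> V" "w \<in> V" using sub by auto
  have nn: "0 \<le> x j" if "j \<in> V" for j using x that by (simp add: weightings_def)
  have nn': "0 \<le> x p" "0 \<le> x d" "0 \<le> x u" "0 \<le> x v" "0 \<le> x w" using nn inV by auto
  have s1: "sum x V = 1" using x by (simp add: weightings_def)
  have finBD: "finite B" "finite D" using fin sub finite_subset by auto
  have SB: "0 \<le> sum x B" and SD: "0 \<le> sum x D" using sub nn by (auto intro!: sum_nonneg)
  have "sum x ({p, d, u, v, w} \<union> (B \<union> D)) \<le> sum x V"
    using sub nn fin by (intro sum_mono2) auto
  moreover have "sum x ({p, d, u, v, w} \<union> (B \<union> D)) = x p + x d + x u + x v + x w + sum x B + sum x D"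
    using disj dist finBD by (subst sum.union_disjoint) (auto simp: sum.union_disjoint)
  ultimately have tot: "x p + x d + x u + x v + x w + sum x B + sum x D \<le> 1"
    by (simp add: s1)
  \<comment> \<open>The trade loses only if the weights it charges are positive.
    This is what makes the first-order conditions below available.\<close>
  have zpos: "0 < x w" using False nn'(5) by (cases "x w = 0") auto
  then have "x u * x d < x v * x p" using False by (simp add: zero_le_mult_iff)
  moreover have "0 \<le> x u * x d" using nn' by simp
  ultimately have "0 < x v * x p" by linarith
  then have ypos: "0 < x v" and ppos: "0 < x p" using nn' by (auto simp: zero_less_mult_iff)
  have opt: "f (transfer x a b \<epsilon>) - f x \<le> 0"
    if "a \<in> V" "b \<in> V" "a \<noteq> b" "0 \<le> \<epsilon>" "\<epsilon> \<le> x b" for a b \<epsilon>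
    using max[OF transfer_weightings[OF fin that(1-3) x _ that(5)]] nn[OF that(1)] that(4) by simp
  note simps = sum_transfer_other esym3_transfer[OF fin] s1
  have out: "p \<notin> B" "p \<notin> D" "d \<notin> B" "d \<notin> D" "u \<notin> B" "u \<notin> D" "v \<notin> B" "v \<notin> D" "w \<notin> B" "w \<notin> D"
    and neq: "p \<noteq> d" "p \<noteq> u" "p \<noteq> v" "p \<noteq> w" "d \<noteq> u" "d \<noteq> v" "d \<noteq> w" "u \<noteq> v" "u \<noteq> w" "v \<noteq> w"
    using disj dist by auto
  note neq' = neq neq[symmetric]
  have foc: "(x b - x a) * K + J \<le> 0"
    if "0 < x b" "a \<in> V" "b \<in> V" "a \<noteq> b"
      and "\<And>\<epsilon>. f (transfer x a b \<epsilon>) - f x = (\<epsilon> * (x b - x a) - \<epsilon>\<^sup>2) * K + \<epsilon> * J" for a b K J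
  proof (rule first_order_condition[OF that(1)])
    fix \<epsilon> assume "0 \<le> \<epsilon>" "\<epsilon> \<le> x b"
    then show "(\<epsilon> * (x b - x a) - \<epsilon>\<^sup>2) * K + \<epsilon> * J \<le> 0"
      using opt[OF that(2-4), of \<epsilon>] that(5)[of \<epsilon>] by linarith
  qed
  \<comment> \<open>The comparisons come in this order because mass can be moved only out of a vertex
    known to be positive: \<open>w\<close>, \<open>v\<close> and \<open>p\<close> are, and they give \<open>u\<close> and \<open>d\<close>.\<close>
  have zv: "(x w - x v) * (1 - x v - x w - (sum x B + sum x D + x d + x u))
      + x u * (sum x D + x d) \<le> 0"
    using out neq' inV by (intro foc zpos inV neq')
      (simp add: f simps, simp add: transfer_def algebra_simps power2_eq_square)
  have yx: "(x v - x u) * (1 - x u - x v - x w) + x w * sum x B \<le> 0"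
    using out neq' inV by (intro foc ypos inV neq')
      (simp add: f simps, simp add: transfer_def algebra_simps power2_eq_square)
  have zd: "(x w - x d) * (1 - x d - x w - x u - x v)
      + (x v * (sum x B + sum x D + x u) + x u * sum x D) \<le> 0"
    using out neq' inV by (intro foc zpos inV neq')
      (simp add: f simps, simp add: transfer_def algebra_simps power2_eq_square)
  define R where "R = 1 - x u - x v - x w"
  define P where "P = 1 - x p - x d"
  have Rpos: "0 < R" and Rs: "x p + x d \<le> R"
    using tot nn' SB SD ppos by (auto simp: R_def)
  have zley: "x w \<le> x v"
  proof (rule ccontr)
    assume "\<not> ?thesis"
    then have "0 < (x w - x v) * (1 - x v - x w - (sum x B + sum x D + x d + x u))"
      using tot ppos by (intro mult_pos_pos) auto
    moreover have "0 \<le> x u * (sum x D + x d)" using nn' SD by simp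
    ultimately show False using zv by linarith
  qed
  have ylex: "x v \<le> x u"
  proof (rule ccontr)
    assume "\<not> ?thesis"
    then have "0 < (x v - x u) * R" using Rpos by simp
    moreover have "0 \<le> x w * sum x B" using nn' SB by simp
    ultimately show False using yx by (simp add: R_def)
  qed
  have xpos: "0 < x u" using ypos ylex by simp
  have zled: "x w \<le> x d"
  proof (rule ccontr)
    assume "\<not> ?thesis"
    then have "0 < (x w - x d) * (1 - x d - x w - x u - x v)"
      using tot ppos SB SD by (intro mult_pos_pos) auto
    moreover have "0 \<le> x v * (sum x B + sum x D + x u) + x u * sum x D"
      using nn' SB SD by simp
    ultimately show False using zd by linarith
  qed
  have dpos: "0 < x d" using zled zpos by simp
  have xy: "(x u - x v) * R + (- (x w * sum x B)) \<le> 0"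
    using out neq' inV by (intro foc xpos inV neq')
      (simp add: f simps R_def, simp add: transfer_def algebra_simps power2_eq_square)
  have dp: "(x d - x p) * P + x w * (x u + x v) \<le> 0"
    using out neq' inV by (intro foc dpos inV neq')
      (simp add: f simps P_def, simp add: transfer_def algebra_simps power2_eq_square)
  have pd: "(x p - x d) * P + (- (x w * (x u + x v))) \<le> 0"
    using out neq' inV by (intro foc ppos inV neq')
      (simp add: f simps P_def, simp add: transfer_def algebra_simps power2_eq_square)
  have yp: "(x v - x p) * (1 - x p - x v) + x w * (sum x B + sum x D + x d + x u) \<le> 0"
    using out neq' inV by (intro foc ypos inV neq')
      (simp add: f simps, simp add: transfer_def algebra_simps power2_eq_square)
  have xd: "(x u - x d) * (1 - x d - x u - x w) + x w * sum x D \<le> 0"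
    using out neq' inV by (intro foc xpos inV neq')
      (simp add: f simps, simp add: transfer_def algebra_simps power2_eq_square)
  have ylep: "x v \<le> x p"
  proof (rule ccontr)
    assume "\<not> ?thesis"
    then have "0 < (x v - x p) * (1 - x p - x v)"
      using tot xpos nn' SB SD by (intro mult_pos_pos) auto
    moreover have "0 \<le> x w * (sum x B + sum x D + x d + x u)" using nn' SB SD by simp
    ultimately show False using yp by linarith
  qed
  have xled: "x u \<le> x d"
  proof (rule ccontr)
    assume "\<not> ?thesis"
    then have "0 < (x u - x d) * (1 - x d - x u - x w)"
      using tot ppos nn' SB SD by (intro mult_pos_pos) auto
    moreover have "0 \<le> x w * sum x D" using nn' SD by simp
    ultimately show False using xd by linarith
  qed
  define s where "s = x p + x d"
  define W where "W = x u + x v"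
  \<comment> \<open>\<open>\<eta>\<close> equalises \<open>p\<close> and \<open>d\<close>. In the new graph the derivative from \<open>v\<close> to \<open>u\<close> is
    \<open>x w * s\<close> and the second-order coefficient is \<open>- R\<close>; \<open>\<epsilon>\<close> is the vertex of that parabola.\<close>
  define \<epsilon> where "\<epsilon> = x w * s / (2 * R)"
  define \<eta> where "\<eta> = (x p - x d) / 2"
  have Ppos: "0 < P" using tot nn' SB SD xpos by (auto simp: P_def)
  \<comment> \<open>Both vertices of each of the pairs \<open>p, d\<close> and \<open>u, v\<close> carry weight,
    so transfers in both directions give equalities.\<close>
  have eqP: "(x p - x d) * P = x w * W" using dp pd by (simp add: W_def algebra_simps)
  have eqR: "(x u - x v) * R = x w * sum x B" using yx xy by (simp add: R_def algebra_simps)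
  have key: "W\<^sup>2 * R \<le> s\<^sup>2 * P"
    using sq_times_complement_mono[of W s "x w"] tot nn' SB SD ylep xled
    by (auto simp: W_def s_def R_def P_def algebra_simps)
  have eR: "\<epsilon> * R = x w * s / 2" using Rpos by (simp add: \<epsilon>_def)
  have e0: "0 \<le> \<epsilon>" using nn' Rpos by (simp add: \<epsilon>_def s_def)
  have "x w * s \<le> x v * (2 * R)"
    using zley Rs nn' Rpos by (intro mult_mono) (auto simp: s_def)
  then have ey: "\<epsilon> \<le> x v" using Rpos by (simp add: \<epsilon>_def divide_le_eq)
  define x1 where "x1 = transfer x d p \<eta>"
  define x2 where "x2 = transfer x1 u v \<epsilon>"
  have x1W: "x1 \<in> weightings V"
    unfolding x1_def using inV neq' nn' by (intro transfer_weightings fin x) (auto simp: \<eta>_def)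
  have x1v: "x1 v = x v" "x1 u = x u" "x1 w = x w" "x1 d = x d + \<eta>" "x1 p = x p - \<eta>"
    using neq' by (simp_all add: x1_def transfer_def)
  have x1s: "sum x1 B = sum x B" "sum x1 D = sum x D" "sum x1 V = 1"
    using out x1W by (simp_all add: x1_def sum_transfer_other weightings_def)
  have x2W: "x2 \<in> weightings V"
    unfolding x2_def using inV neq' nn' e0 ey x1v by (intro transfer_weightings fin x1W) auto
  have x2v: "x2 v = x v - \<epsilon>" "x2 u = x u + \<epsilon>" "x2 w = x w" "x2 d = x d + \<eta>" "x2 p = x p - \<eta>"
    using neq' x1v by (simp_all add: x2_def transfer_def)
  have x2s: "sum x2 B = sum x B" "sum x2 D = sum x D"
    using out x1s by (simp_all add: x2_def sum_transfer_other)
  have e1: "esym 3 V x1 = esym 3 V x + (\<eta> * (x p - x d) - \<eta>\<^sup>2) * P"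
    unfolding x1_def esym3_transfer[OF fin inV(2,1) neq(1)[symmetric]] s1 P_def
    by (simp add: algebra_simps)
  have e2: "esym 3 V x2 = esym 3 V x1 + (\<epsilon> * (x v - x u) - \<epsilon>\<^sup>2) * (R + x w)"
    unfolding x2_def esym3_transfer[OF fin inV(3,4) neq(8)] x1s x1v R_def
    by (simp add: algebra_simps)
  have "g x2 - f x = x w * (x u * x d - x v * x p) + (\<eta> * (x p - x d) - \<eta>\<^sup>2) * P
      + \<epsilon> * (x w * sum x B + x w * s - (x u - x v) * R) - \<epsilon> * (\<epsilon> * R)"
    unfolding f g e2 e1 x2v x2s s_def by (simp add: algebra_simps power2_eq_square)
  also have "\<dots> = x w * (x u * x d - x v * x p) + (x p - x d) * ((x p - x d) * P) / 4 + \<epsilon> * (x w * s) / 2"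
    unfolding eqR eR \<eta>_def by (simp add: field_simps power2_eq_square)
  also have "\<dots> = x w * ((x u - x v) * s - (x p - x d) * W) / 2
      + (x p - x d) * (x w * W) / 4 + \<epsilon> * (x w * s) / 2"
    unfolding eqP by (simp add: s_def W_def field_simps)
  also have "\<dots> = x w * (x u - x v) * s / 2 + x w * (2 * \<epsilon> * s - (x p - x d) * W) / 4"
    by (simp add: field_simps)
  also have "\<dots> \<ge> 0"
  proof -
    have "(x p - x d) * W \<le> 2 * \<epsilon> * s"
    proof -
      have "(x p - x d) * W * (P * R) = ((x p - x d) * P) * (W * R)"
        by (simp add: ac_simps)
      also have "\<dots> = x w * (W\<^sup>2 * R)"
        unfolding eqP by (simp add: power2_eq_square ac_simps)
      also have "\<dots> \<le> x w * (s\<^sup>2 * P)" using key nn' by (intro mult_left_mono) auto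
      also have "\<dots> = 2 * (\<epsilon> * R) * (s * P)"
        unfolding eR by (simp add: power2_eq_square ac_simps)
      also have "\<dots> = (2 * \<epsilon> * s) * (P * R)"
        by (simp add: ac_simps)
      finally show ?thesis using Ppos Rpos by simp
    qed
    moreover have "0 \<le> s" using nn' by (simp add: s_def)
    ultimately show ?thesis using nn' ylex by simp
  qed
  finally have "f x \<le> g x2" by simp
  then show ?thesis using x2W by blast
qed

section \<open>Complete 3-graphs with two fans removed\<close>

text \<open>
  The triples contain \<open>t\<close>; the pairs that remain after removing \<open>t\<close> form a star at \<open>t - 1\<close> with \<open>b\<close>
  leaves and a star at \<open>t - 2\<close> with \<open>i\<close> leaves, the edge between the two centres being counted in the
  first star. For \<open>i = 0\<close> and \<open>t \<ge> 3\<close> the second interval is empty.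
\<close>

definition two_fan :: "nat \<Rightarrow> nat \<Rightarrow> nat \<Rightarrow> nat set set" where
  "two_fan t b i =
     (\<lambda>p. {p, t - 1, t}) ` {t - 1 - b..t - 2} \<union> (\<lambda>p. {p, t - 2, t}) ` {t - 2 - i..t - 3}"

definition two_fan_graph :: "nat \<Rightarrow> nat \<Rightarrow> nat \<Rightarrow> graph3" where
  "two_fan_graph t b i = ({1..t}, nsets {1..t} 3 - two_fan t b i)"

lemma two_fan_subset:
  assumes "3 \<le> t" "b \<le> t - 2" "i \<le> t - 3"
  shows "two_fan t b i \<subseteq> nsets {1..t} 3"
proof
  fix e assume "e \<in> two_fan t b i"
  then obtain p q where e: "e = {p, q, t}" and "1 \<le> p" "p < q" "q < t"
    using assms by (fastforce simp: two_fan_def)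
  then show "e \<in> nsets {1..t} 3" by (auto simp: nsets_def)
qed

lemma sum_two_fan:
  fixes h :: "nat set \<Rightarrow> 'a::comm_monoid_add"
  assumes "3 \<le> t"
  shows "(\<Sum>e\<in>two_fan t b i. h e)
       = (\<Sum>p\<in>{t - 1 - b..t - 2}. h {p, t - 1, t}) + (\<Sum>p\<in>{t - 2 - i..t - 3}. h {p, t - 2, t})"
proof -
  have "inj_on (\<lambda>p. {p, t - 1, t}) {t - 1 - b..t - 2}"
    using assms by (intro inj_onI) (auto simp: insert_eq_iff doubleton_eq_iff)
  moreover have "inj_on (\<lambda>p. {p, t - 2, t}) {t - 2 - i..t - 3}"
    using assms by (intro inj_onI) (auto simp: insert_eq_iff doubleton_eq_iff)
  moreover have "(\<lambda>p. {p, t - 1, t}) ` {t - 1 - b..t - 2} \<inter> (\<lambda>p. {p, t - 2, t}) ` {t - 2 - i..t - 3} = {}"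
  proof -
    have "{p, t - 1, t} \<noteq> {q, t - 2, t}" if "q \<le> t - 3" for p q
    proof -
      have "t - 1 \<notin> {q, t - 2, t}" using that assms by auto
      then show ?thesis by blast
    qed
    then show ?thesis by fastforce
  qed
  ultimately show ?thesis
    by (simp add: two_fan_def sum.union_disjoint sum.reindex)
qed

lemma card_two_fan:
  assumes "3 \<le> t" "b \<le> t - 2" "i \<le> t - 3"
  shows "card (two_fan t b i) = b + i"
  using sum_two_fan[OF assms(1), of "\<lambda>_. 1::nat" b i] assms by simp

lemma edge_poly_two_fan_graph:
  assumes "3 \<le> t" "b \<le> t - 2" "i \<le> t - 3"
  shows "edge_poly (two_fan_graph t b i) x = esym 3 {1..t} x
      - x t * (x (t - 1) * sum x {t - 1 - b..t - 2} + x (t - 2) * sum x {t - 2 - i..t - 3})"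
proof -
  have "edge_poly (two_fan_graph t b i) x
      = esym 3 {1..t} x - (\<Sum>e\<in>two_fan t b i. \<Prod>j\<in>e. x j)"
    unfolding edge_poly_def esym_def two_fan_graph_def
    using two_fan_subset[OF assms] by (simp add: sum_diff finite_imp_finite_nsets)
  moreover have "(\<Prod>j\<in>{p, t - 1, t}. x j) = x t * (x (t - 1) * x p)"
    if "p \<in> {t - 1 - b..t - 2}" for p
  proof -
    have "p \<noteq> t - 1" "p \<noteq> t" "t - 1 \<noteq> t" using that assms by auto
    then show ?thesis by (simp add: algebra_simps)
  qed
  moreover have "(\<Prod>j\<in>{p, t - 2, t}. x j) = x t * (x (t - 2) * x p)"
    if "p \<in> {t - 2 - i..t - 3}" for p
  proof -
    have "p \<noteq> t - 2" "p \<noteq> t" "t - 2 \<noteq> t" using that assms by auto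
    then show ?thesis by (simp add: algebra_simps)
  qed
  ultimately show ?thesis
    using sum_two_fan[OF assms(1), of "\<lambda>e. \<Prod>j\<in>e. x j" b i]
    by (simp add: sum_distrib_left distrib_left)
qed

text \<open>
  The triple \<open>{t - 2 - i, t - 2, t}\<close> becomes an edge and \<open>{t - 2 - b, t - 1, t}\<close> ceases to be one. The
  hypothesis \<open>i < b\<close> makes \<open>t - 2 - b\<close> lie outside both fans, and \<open>b + i \<le> t - 2\<close> makes it a vertex.
\<close>

lemma lagrangian_two_fan_step:
  assumes "1 \<le> i" "i < b" "b + i \<le> t - 2"
  shows "lagrangian (two_fan_graph t b i) \<le> lagrangian (two_fan_graph t (b + 1) (i - 1))"
proof -
  have three: "three_graph (two_fan_graph t b' i')" for b' i'
    by (simp add: three_graph_def two_fan_graph_def)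
  have verts: "verts (two_fan_graph t b' i') = {1..t}" for b' i'
    by (simp add: two_fan_graph_def)
  note att = lagrangian_attained[OF three, unfolded verts]
  \<comment> \<open>Besides the distinguished vertices, \<open>B\<close> are the leaves of the first star only
    and \<open>D\<close> those of both.\<close>
  define B where "B = {t - 1 - b..t - 3 - i}"
  define D where "D = {t - 1 - i..t - 3}"
  have bD: "{t - 2 - i..t - 3} = insert (t - 2 - i) D"
    using assms by (auto simp: D_def)
  have bB: "{t - 1 - b..t - 2} = insert (t - 2) (insert (t - 2 - i) (B \<union> D))"
    using assms by (auto simp: D_def B_def)
  have bB': "{t - 1 - (b + 1)..t - 2}
      = insert (t - 2 - b) (insert (t - 2) (insert (t - 2 - i) (B \<union> D)))"
    using assms by (auto simp: D_def B_def)
  have bD': "{t - 2 - (i - 1)..t - 3} = D"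
    using assms by (auto simp: D_def)
  have disj: "B \<inter> D = {}" and out: "t - 2 \<notin> B \<union> D" "t - 2 - i \<notin> B \<union> D" "t - 2 - b \<notin> B \<union> D"
      "t - 1 \<notin> B \<union> D" "t \<notin> B \<union> D"
    and neq: "t - 2 \<noteq> t - 2 - i" "t - 2 \<noteq> t - 2 - b" "t - 2 - i \<noteq> t - 2 - b"
    and fin: "finite B" "finite D"
    using assms by (auto simp: B_def D_def)
  have "\<exists>x\<in>weightings {1..t}.
          lagrangian (two_fan_graph t b i) = edge_poly (two_fan_graph t b i) x \<and>
          (\<forall>y\<in>weightings {1..t}. edge_poly (two_fan_graph t b i) y \<le> edge_poly (two_fan_graph t b i) x)"
    using assms by (intro att) auto
  then obtain x where x: "x \<in> weightings {1..t}"
    and lx: "lagrangian (two_fan_graph t b i) = edge_poly (two_fan_graph t b i) x"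
    and mx: "\<And>y. y \<in> weightings {1..t} \<Longrightarrow>
        edge_poly (two_fan_graph t b i) y \<le> edge_poly (two_fan_graph t b i) x"
    by blast
  have "\<exists>y\<in>weightings {1..t}. edge_poly (two_fan_graph t b i) x
      \<le> edge_poly (two_fan_graph t (b + 1) (i - 1)) y"
  proof (rule exchange_step[where V = "{1..t}" and f = "edge_poly (two_fan_graph t b i)"
        and g = "edge_poly (two_fan_graph t (b + 1) (i - 1))"
        and p = "t - 2 - b" and d = "t - 2 - i" and u = "t - 2" and v = "t - 1" and w = t
        and B = B and D = D, OF _ _ _ disj _ _ _ x mx])
    show "{t - 2 - b, t - 2 - i, t - 2, t - 1, t} \<union> B \<union> D \<subseteq> {1..t}"
      using assms by (auto simp: B_def D_def)
    show "distinct [t - 2 - b, t - 2 - i, t - 2, t - 1, t]"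
      using assms by auto
    show "{t - 2 - b, t - 2 - i, t - 2, t - 1, t} \<inter> (B \<union> D) = {}"
      using out by auto
    show "edge_poly (two_fan_graph t b i) y = esym 3 {1..t} y
      - y t * (y (t - 1) * (sum y B + sum y D + y (t - 2 - i) + y (t - 2))
          + y (t - 2) * (sum y D + y (t - 2 - i)))" for y
      using assms out neq fin disj
      by (subst edge_poly_two_fan_graph)
         (auto simp only: bB bD, auto simp: sum.union_disjoint algebra_simps)
    show "edge_poly (two_fan_graph t (b + 1) (i - 1)) y = esym 3 {1..t} y
      - y t * (y (t - 1) * (sum y B + sum y D + y (t - 2 - i) + y (t - 2 - b) + y (t - 2))
          + y (t - 2) * sum y D)" for y
      using assms out neq fin disj
      by (subst edge_poly_two_fan_graph)
         (auto simp only: bB' bD', auto simp: sum.union_disjoint algebra_simps)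
  qed auto
  moreover have "\<exists>x\<in>weightings {1..t}.
          lagrangian (two_fan_graph t (b + 1) (i - 1)) = edge_poly (two_fan_graph t (b + 1) (i - 1)) x \<and>
          (\<forall>y\<in>weightings {1..t}. edge_poly (two_fan_graph t (b + 1) (i - 1)) y
              \<le> edge_poly (two_fan_graph t (b + 1) (i - 1)) x)"
    using assms by (intro att) auto
  ultimately show ?thesis
    unfolding lx by fastforce
qed

lemma lagrangian_two_fan_le_fan:
  assumes "i < b" "b + i \<le> t - 2"
  shows "lagrangian (two_fan_graph t b i) \<le> lagrangian (two_fan_graph t (b + i) 0)"
  using assms
proof (induction i arbitrary: b)
  case (Suc i)
  have "lagrangian (two_fan_graph t b (Suc i)) \<le> lagrangian (two_fan_graph t (b + 1) i)"
    using lagrangian_two_fan_step[of "Suc i" b t] Suc.prems by simp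
  also have "\<dots> \<le> lagrangian (two_fan_graph t (b + 1 + i) 0)"
    using Suc.prems by (intro Suc.IH) auto
  finally show ?case by simp
qed simp

section \<open>Colex order and the shape of the two graphs\<close>

text \<open>
  Two colex-initial families of the same size agree: each member of \<open>S\<close> has all its predecessors in
  \<open>S\<close>, hence fewer than \<open>m\<close> of them.
\<close>

lemma colex_initial_eqI:
  assumes sub: "S \<subseteq> nsets {1..} 3" and fin: "finite S" and card: "card S = m"
    and down: "\<And>A B. A \<in> S \<Longrightarrow> B \<in> nsets {1..} 3 \<Longrightarrow> colex_less B A \<Longrightarrow> B \<in> S"
  shows "colex_initial m = S"
proof -
  have "S \<subseteq> colex_initial m"
  proof
    fix A assume A: "A \<in> S"
    have "{B \<in> nsets {1..} 3. colex_less B A} \<subset> S"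
      using A down by (auto simp: colex_less_def)
    then have "card {B \<in> nsets {1..} 3. colex_less B A} < m"
      using psubset_card_mono[OF fin] card by blast
    then show "A \<in> colex_initial m"
      using A sub by (auto simp: colex_initial_def)
  qed
  moreover have "finite (colex_initial m)"
  proof (cases "m = 0")
    case False
    then show ?thesis using card_colex_initial[of m] by (intro card_ge_0_finite) simp
  qed (simp add: colex_initial_def)
  ultimately show ?thesis
    using card card_colex_initial[of m] card_subset_eq by metis
qed

lemma colex_less_has_larger_witness:
  assumes "colex_less A B" "finite A" "finite B" "k \<in> A" "k \<notin> B"
  shows "\<exists>j\<in>B. k < j \<and> j \<notin> A"
proof -
  let ?j = "Max (sym_diff A B)"
  have "?j \<in> sym_diff A B" using assms by (intro Max_in) auto
  moreover have "?j \<in> B" using assms(1) by (simp add: colex_less_def)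
  moreover have "k \<le> ?j" using assms by (intro Max_ge) auto
  ultimately show ?thesis using assms by (metis DiffE UnE order_le_less)
qed

lemma three_subset_containing:
  assumes "e \<in> nsets {1..t::nat} 3" "t \<in> e"
  obtains p q where "e = {p, q, t}" "1 \<le> p" "p < q" "q < t"
proof -
  have fe: "finite e" "card e = 3" "e \<subseteq> {1..t}" using assms by (auto simp: nsets_def)
  then have "card (e - {t}) = 2" using assms by simp
  then obtain a b where ab: "e - {t} = {a, b}" "a \<noteq> b" by (auto simp: card_2_iff)
  then have e: "e = {a, b, t}" using assms(2) by blast
  have ran: "a \<in> {1..t}" "b \<in> {1..t}" "a \<noteq> t" "b \<noteq> t" using ab fe by auto
  show ?thesis
  proof (cases "a < b")
    case True then show ?thesis using that[of a b] e ran by auto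
  next
    case False
    moreover have "e = {b, a, t}" using e by auto
    ultimately show ?thesis using that[of b a] ab(2) ran by auto
  qed
qed

text \<open>
  In colex order the last triples of \<open>{1..t}\<close> are those that contain \<open>t - 1\<close> and \<open>t\<close>, sorted by their
  third element; there are \<open>t - 2\<close> of them, so for \<open>a \<le> t - 2\<close> only such triples are left out. All
  vertices are still covered, so the vertex set is \<open>{1..t}\<close> as well.
\<close>

lemma colex_graph_eq_two_fan_graph:
  assumes "3 \<le> a" "a \<le> t - 2"
  shows "colex_graph ((t choose 3) - a) = two_fan_graph t a 0"
proof -
  define S where "S = nsets {1..t} 3 - two_fan t a 0"
  have t: "5 \<le> t" using assms by simp
  have fan: "two_fan t a 0 = (\<lambda>p. {p, t - 1, t}) ` {t - 1 - a..t - 2}"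
    using t by (auto simp: two_fan_def)
  have "card S = (t choose 3) - a"
    unfolding S_def using two_fan_subset[of t a 0] card_two_fan[of t a 0] t assms
    by (subst card_Diff_subset) (auto intro: finite_subset[OF _ finite_imp_finite_nsets])
  moreover have "B \<in> S" if A: "A \<in> S" and B: "B \<in> nsets {1..} 3" and less: "colex_less B A" for A B
  proof -
    have fA: "finite A" "A \<subseteq> {1..t}" and fB: "finite B" "B \<subseteq> {1..}" "card B = 3"
      using A B by (auto simp: S_def nsets_def)
    note wit = colex_less_has_larger_witness[OF less fB(1) fA(1)]
    have "k \<le> t" if "k \<in> B" for k
      using wit[OF that] fA by (cases "k \<in> A") fastforce+
    then have B3: "B \<in> nsets {1..t} 3" using fB by (auto simp: nsets_def)
    have "B \<notin> two_fan t a 0"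
    proof
      assume "B \<in> two_fan t a 0"
      then obtain p where p: "B = {p, t - 1, t}" "t - 1 - a \<le> p" "p \<le> t - 2"
        by (auto simp: fan)
      have tA: "t \<in> A" using wit[of t] p fA by fastforce
      then have t1A: "t - 1 \<in> A" using wit[of "t - 1"] p fA by fastforce
      obtain q r where qr: "A = {q, r, t}" "1 \<le> q" "q < r" "r < t"
        using A tA three_subset_containing unfolding S_def by blast
      then have "r = t - 1" using t1A by auto
      moreover have "p \<le> q"
        using wit[of p] p qr \<open>r = t - 1\<close> by (cases "p \<in> A") auto
      ultimately have "A \<in> two_fan t a 0"
        using qr p by (auto simp: fan)
      then show False using A by (simp add: S_def)
    qed
    then show ?thesis using B3 by (simp add: S_def)
  qed
  moreover have S: "S \<subseteq> nsets {1..} 3" "finite S"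
    by (auto simp: S_def finite_imp_finite_nsets) (auto simp: nsets_def)
  ultimately have "colex_initial ((t choose 3) - a) = S"
    using S by (intro colex_initial_eqI) blast+
  moreover have "\<Union>S = {1..t}"
  proof
    show "\<Union>S \<subseteq> {1..t}" by (auto simp: S_def nsets_def)
    show "{1..t} \<subseteq> \<Union>S"
    proof
      fix k assume k: "k \<in> {1..t}"
      have "{1, 2, max 3 k} \<in> S"
      proof -
        have "\<not> {t - 1, t} \<subseteq> {1, 2, max 3 k}" using t by auto
        then have "{1, 2, max 3 k} \<notin> two_fan t a 0" by (fastforce simp: fan)
        moreover have "{1, 2, max 3 k} \<in> nsets {1..t} 3" using k t by (auto simp: nsets_def)
        ultimately show ?thesis by (simp add: S_def)
      qed
      moreover have "k \<in> {1, 2, max 3 k}" using k by auto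
      ultimately show "k \<in> \<Union>S" by blast
    qed
  qed
  ultimately show ?thesis
    by (simp add: colex_graph_def two_fan_graph_def S_def)
qed

text \<open>
  The colex-minimal non-edge \<open>T\<close> forces every other non-edge to contain \<open>t\<close> and one of \<open>t - 2\<close>,
  \<open>t - 1\<close>, with a third element that is at least \<open>t - 2 - i\<close> in the former case. Non-edges of a
  left-compressed graph are closed upwards, so the non-edges through \<open>t - 1\<close> and \<open>t\<close> are given by a
  final segment of the third element. It contains \<open>t - 2 - i\<close>, since \<open>{t - 2 - i, t - 1, t}\<close> lies
  above \<open>T\<close>, and this gives \<open>i < b\<close>.
\<close>

lemma complement_eq_two_fan:
  assumes G: "three_graph G" "verts G = {1..t}" "left_compressed G"
    and i: "1 \<le> i"
    and min: "is_colex_min {t - 2 - i, t - 2, t} (edges (complement3 G))"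
  obtains b where "i < b" "b \<le> t - 2" "i \<le> t - 3" "edges (complement3 G) = two_fan t b i"
proof -
  define N where "N = nsets {1..t} 3 - edges G"
  have N: "edges (complement3 G) = N" using G by (simp add: complement3_def N_def)
  define T where "T = {t - 2 - i, t - 2, t}"
  have TN: "T \<in> N" and Tmin: "\<And>e. e \<in> N \<Longrightarrow> e \<noteq> T \<Longrightarrow> colex_less T e"
    using min by (auto simp: is_colex_min_def N T_def)
  have "T \<subseteq> {1..t}" using TN by (auto simp: N_def nsets_def)
  then have i3: "i \<le> t - 3" and t: "4 \<le> t" using i by (auto simp: T_def)
  have fin: "finite e" "e \<subseteq> {1..t}" if "e \<in> N" for e using that by (auto simp: N_def nsets_def)
  have wit: "\<exists>j\<in>e. k < j \<and> j \<notin> T" if "e \<in> N" "k \<in> T" "k \<notin> e" for e k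
    using colex_less_has_larger_witness[OF Tmin fin(1)[OF TN] fin(1) that(2,3)] that by blast
  have up: "{q1, q2, q3} \<in> N"
    if "{p1, p2, p3} \<in> N" "1 \<le> p1" "p1 < p2" "p2 < p3" "p1 \<le> q1" "p2 \<le> q2" "p3 \<le> q3"
      "q1 < q2" "q2 < q3" "q3 \<le> t" for p1 p2 p3 q1 q2 q3
  proof -
    have "{q1, q2, q3} \<in> nsets {1..t} 3" using that by (auto simp: nsets_def)
    moreover have "{q1, q2, q3} \<notin> edges G"
      using G(3) that unfolding left_compressed_def N_def by blast
    ultimately show ?thesis by (simp add: N_def)
  qed
  define Q where "Q = {p. 1 \<le> p \<and> p \<le> t - 2 \<and> {p, t - 1, t} \<in> N}"
  have d: "t - 2 - i \<in> Q"
    using up[of "t - 2 - i" "t - 2" t "t - 2 - i" "t - 1" t] TN i i3 t by (auto simp: Q_def T_def)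
  define q where "q = Min Q"
  have finQ: "finite Q" by (simp add: Q_def)
  have qQ: "q \<in> Q" and qle: "\<And>p. p \<in> Q \<Longrightarrow> q \<le> p"
    using finQ d by (auto simp: q_def intro: Min_in)
  define b where "b = t - 1 - q"
  have q1: "1 \<le> q" "q \<le> t - 2 - i" using qQ qle[OF d] by (auto simp: Q_def)
  have qb: "q = t - 1 - b" using q1 i3 t by (auto simp: b_def)
  have "N = two_fan t b i"
  proof (intro equalityI subsetI)
    fix e assume e: "e \<in> N"
    have "t \<in> e" using wit[OF e, of t] fin(2)[OF e] by (fastforce simp: T_def)
    then obtain p r where pr: "e = {p, r, t}" "1 \<le> p" "p < r" "r < t"
      using e three_subset_containing unfolding N_def by blast
    have r: "t - 2 \<le> r"
    proof (rule ccontr)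
      assume "\<not> ?thesis"
      then have "t - 2 \<notin> e" using pr t by auto
      then obtain j where "j \<in> e" "t - 2 < j" "j \<notin> T"
        using wit[OF e, of "t - 2"] by (auto simp: T_def)
      then show False using pr \<open>\<not> t - 2 \<le> r\<close> by (auto simp: T_def)
    qed
    show "e \<in> two_fan t b i"
    proof (cases "r = t - 1")
      case True
      then have "p \<in> Q" using e pr by (auto simp: Q_def)
      then have "p \<in> {t - 1 - b..t - 2}" using qle qb pr by (auto simp: Q_def)
      then show ?thesis using pr True by (auto simp: two_fan_def)
    next
      case False
      then have r2: "r = t - 2" using r pr by linarith
      have "t - 2 - i \<le> p"
      proof (rule ccontr)
        assume "\<not> ?thesis"
        then have "t - 2 - i \<notin> e" using pr r2 i i3 t by auto
        then obtain j where "j \<in> e" "t - 2 - i < j" "j \<notin> T"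
          using wit[OF e, of "t - 2 - i"] by (auto simp: T_def)
        then show False using pr r2 \<open>\<not> t - 2 - i \<le> p\<close> by (auto simp: T_def)
      qed
      then have "p \<in> {t - 2 - i..t - 3}" using pr r2 by auto
      then show ?thesis using pr r2 by (auto simp: two_fan_def)
    qed
  next
    fix e assume "e \<in> two_fan t b i"
    then consider p where "e = {p, t - 1, t}" "q \<le> p" "p \<le> t - 2"
      | p where "e = {p, t - 2, t}" "t - 2 - i \<le> p" "p \<le> t - 3"
      by (auto simp: two_fan_def qb)
    then show "e \<in> N"
    proof cases
      case 1
      then show ?thesis
        using up[of q "t - 1" t p "t - 1" t] qQ q1 t i by (auto simp: Q_def)
    next
      case 2
      then show ?thesis
        using up[of "t - 2 - i" "t - 2" t p "t - 2" t] TN t i i3 by (auto simp: T_def)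
    qed
  qed
  then show ?thesis
    using that[of b] N q1 i3 t i by (auto simp: b_def)
qed

theorem theorem1p10:
  fixes m t a i :: nat and G :: graph3
  assumes "m > 0" and "t > 0" and "a > 0" and "i \<ge> 1"
    and "m = (t choose 3) - a" and "3 \<le> a" and "a \<le> t - 2"
    and "three_graph G" and "verts G = {1..t}"
    and "left_compressed G"
    and "card (edges G) = m"
    and "is_colex_min {t - 2 - i, t - 2, t} (edges (complement3 G))"
  shows "lagrangian G \<le> lagrangian (colex_graph m)"
proof -
  obtain b where b: "i < b" "b \<le> t - 2" "i \<le> t - 3"
    and N: "edges (complement3 G) = two_fan t b i"
    using complement_eq_two_fan assms by metis
  have sub: "edges G \<subseteq> nsets {1..t} 3" using assms by (simp add: three_graph_def)
  have N': "nsets {1..t} 3 - edges G = two_fan t b i"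
    using N assms by (simp add: complement3_def)
  have "card (two_fan t b i) = (t choose 3) - m"
    using sub finite_subset[OF sub] assms(11) unfolding N'[symmetric]
    by (subst card_Diff_subset) (auto simp: finite_imp_finite_nsets)
  then have "b + i = a" using card_two_fan[of t b i] b assms by simp
  have "G = two_fan_graph t b i"
    using sub N' assms by (auto simp: two_fan_graph_def prod_eq_iff)
  then have "lagrangian G \<le> lagrangian (two_fan_graph t (b + i) 0)"
    using lagrangian_two_fan_le_fan[of i b t] b \<open>b + i = a\<close> assms by simp
  then show ?thesis
    using colex_graph_eq_two_fan_graph[of a t] assms \<open>b + i = a\<close> by simp
qed

end
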